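(* Let $p$ be a prime, $e,l$ positive integers, $q=p^e$, and let $\mathbf f=(f_1,\dots,f_l)\colon\mathbb F_q^2\to\mathbb F_q^l$ be an arbitrary function. With $\mathbf g,\mathbf h,\mathbf f_0,\tilde{\mathbf f},\tilde{\mathbf f}_0$ defined from $\mathbf f$ as in the context, let $D=D(q;\mathbf f)$, $D_0=D(q;\mathbf f_0)$, let $W_0=\langle \mathrm{Im}(\tilde{\mathbf f}_0)\rangle$ be the $\mathbb F_p$-span of the image of $\tilde{\mathbf f}_0$, and let $d=\dim_{\mathbb F_p}(W_0)$. Then the following hold. (i) If $q$ is odd, then the digraphs $D$ and $D_0$ are isomorphic. Furthermore, for every vertex $(u,\mathbf v)\in\mathbb F_q\times\mathbb F_q^l$, the vertex set of the strong component of $D_0$ containing $(u,\mathbf v)$ is $$\{(a,\mathbf v+\mathbf h(a)-\mathbf g(u)+W_0)\colon a\in\mathbb F_q\}\cup\{(b,-\mathbf v+\mathbf h(b)+\mathbf g(u)+W_0)\colon b\in\mathbb F_q\},$$ and the vertex set of the strong component of $D$ containing $(u,\mathbf v)$ is $$\{(a,\mathbf v+\mathbf h(a)-\mathbf g(u)+W_0)\colon a\in\mathbb F_q\}\cup\{(b,-\mathbf v+\mathbf h(b)+\mathbf g(u)+\mathbf f(0,0)+W_0)\colon b\in\mathbb F_q\}.$$ In particular, $D\cong D_0$ is strong if and only if $W_0=\mathbb F_q^l$ or, equivalently, $d=el$. If $q$ is even, then the vertex set of the strong component of $D$ containing a vertex $(u,\mathbf v)$ is $$\{(a,\mathbf v+\mathbf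 h(a)+\mathbf g(u)+W_0)\colon a\in\mathbb F_q\}\cup\{(a,\mathbf v+\mathbf h(a)+\mathbf g(u)+\mathbf f(0,0)+W_0)\colon a\in\mathbb F_q\}$$ $$=\{(a,\mathbf v+\mathbf h(a)+\mathbf g(u)+W)\colon a\in\mathbb F_q\},$$ where $W=W_0+\langle\{\mathbf f(0,0)\}\rangle=\langle\mathrm{Im}(\tilde{\mathbf f})\rangle$. (ii) If $q$ is odd, then $D\cong D_0$ has $(p^{el-d}+1)/2$ strong components. One of them is of order $p^{e+d}$. All other $(p^{el-d}-1)/2$ strong components are isomorphic (to one another), and each is of order $2p^{e+d}$. If $q$ is even, then the number of strong components in $D$ is $2^{el-d}$ if $\mathbf f(0,0)\in W_0$, and it is $2^{el-d-1}$ otherwise. In each case, all strong components are isomorphic, and they are of orders $2^{e+d}$ and $2^{e+d+1}$, respectively.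
   Context: A digraph is a pair $(V,A)$ with $A\subseteq V\times V$ (loops are allowed). Its order is $|V|$. A vertex $y$ is reachable from $x$ if there is a directed walk from $x$ to $y$; each vertex is reachable from itself. A digraph is strong (strongly connected) if for every pair of distinct vertices $x,y$, $y$ is reachable from $x$ and $x$ is reachable from $y$. A strong component is a maximal induced subdigraph that is strong. $\mathbb F_q$ is the finite field with $q$ elements. For a function $\mathbf f=(f_1,\dots,f_l)\colon\mathbb F_q^2\to\mathbb F_q^l$, the digraph $D(q;\mathbf f)$ has vertex set $\mathbb F_q^{l+1}$, and there is an arc from $(x_1,\dots,x_{l+1})$ to $(y_1,\dots,y_{l+1})$ if and only if $x_i+y_i=f_{i-1}(x_1,y_1)$ for all $i$ with $2\le i\le l+1$. A vertex $(v_1,\dots,v_{l+1})$ is also written as $(v_1,\mathbf v)\in\mathbb F_q\times\mathbb F_q^l$ with $\mathbf v=(v_2,\dots,v_{l+1})$. For $X\subseteq\mathbb F_q^l$, $\langle X\rangle$ denotes the span of $X$ over $\mathbb F_p$; $\mathbf v+X=\{\mathbf v+\mathbf x\colon\mathbf x\in X\}$. For $a\in\mathbb F_q$ and $X\subseteq \mathbb F_q^l$, the notation $(a,X)$ stands for all vertices $(a,\mathbf x)$ with $\mathbf x\in X$; so $\{(a,\mathbf c(a)+W_0)\colon a\in\mathbb F_q\}$ means $\{(a,\mathbf c(a)+\mathbf w)\colon a\in\mathbb F_q,\ \mathbf w\in W_0\}$. $\mathrm{Im}(\mathbf f)=\{\mathbf f(x,y)\colon (x,y)\in\mathbb F_q^2\}$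 is the image of $\mathbf f$, and likewise for other functions. For $\mathbf f\colon\mathbb F_q^2\to\mathbb F_q^l$ define $\mathbf g(t)=\mathbf f(t,0)-\mathbf f(0,0)$, $\mathbf h(t)=\mathbf f(0,t)-\mathbf f(0,0)$, $\tilde{\mathbf f}(x,y)=\mathbf f(x,y)-\mathbf g(y)-\mathbf h(x)$, $\mathbf f_0(x,y)=\mathbf f(x,y)-\mathbf f(0,0)$, and $\tilde{\mathbf f}_0(x,y)=\mathbf f_0(x,y)-\mathbf g(y)-\mathbf h(x)$ (note that $\mathbf g$ is evaluated at $y$ and $\mathbf h$ at $x$). *)

theory Defs
  imports
    "HOL-Analysis.Cartesian_Space"
    "Graph_Theory.Digraph_Isomorphism"
    "Berlekamp_Zassenhaus.Finite_Field"
begin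

text \<open>
  \<open>'a ring_char mod_ring\<close> is the field of integers modulo the characteristic of \<^typ>\<open>'a\<close>, so
  for \<open>'a\<close> a finite field with \<open>p ^ e\<close> elements it is the field with \<open>p\<close> elements.  It acts
  on vectors over \<open>'a\<close> through its embedding as the prime subfield of \<open>'a\<close>.
\<close>

definition prime_field_scale ::
    "('a :: finite_field) ring_char mod_ring \<Rightarrow> 'a ^ 'l \<Rightarrow> 'a ^ 'l"
  where "prime_field_scale c v = of_int (to_int_mod_ring c) *s v"

lemma of_int_to_int_mod_ring_hom:
  fixes c d :: "('a :: finite_field) ring_char mod_ring"
  shows "(of_int (to_int_mod_ring (c + d)) :: 'a)
           = of_int (to_int_mod_ring c) + of_int (to_int_mod_ring d)"
    and "(of_int (to_int_mod_ring (c * d)) :: 'a)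
           = of_int (to_int_mod_ring c) * of_int (to_int_mod_ring d)"
  by (simp_all add: to_int_mod_ring_add to_int_mod_ring_mult)

global_interpretation Fp: vector_space
  "prime_field_scale :: ('a :: finite_field) ring_char mod_ring \<Rightarrow> 'a ^ 'l \<Rightarrow> 'a ^ 'l"
  by unfold_locales
    (simp_all add: prime_field_scale_def of_int_to_int_mod_ring_hom vec_eq_iff algebra_simps)

lemma CARD_prime_field:
  assumes "prime p" and "CARD('a :: finite_field) = p ^ e"
  shows "CARD('a ring_char mod_ring) = p"
proof -
  have "CHAR('a) dvd p ^ e"
    using CHAR_dvd_CARD[where ?'a = 'a] assms(2) by simp
  moreover have "prime CHAR('a)" by simp
  ultimately have "CHAR('a) = p"
    using assms(1) prime_dvd_power primes_dvd_imp_eq by blast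
  then show ?thesis by simp
qed

text \<open>
  The vertex set \<open>F\<^sub>q\<^bsup>l+1\<^esup>\<close> is taken as pairs of the first coordinate and the vector of the
  remaining \<open>l\<close> coordinates.
\<close>

definition fdigraph ::
    "('a \<times> 'a \<Rightarrow> ('a :: finite_field) ^ 'l)
       \<Rightarrow> ('a \<times> ('a ^ 'l), ('a \<times> ('a ^ 'l)) \<times> ('a \<times> ('a ^ 'l))) pre_digraph"
  where "fdigraph f = with_proj
    \<lparr>pverts = UNIV,
     parcs = {((x, xs), (y, ys)) | x xs y ys. \<forall>i. xs $ i + ys $ i = f (x, y) $ i}\<rparr>"

definition g_part :: "('a \<times> 'a \<Rightarrow> ('a :: finite_field) ^ 'l) \<Rightarrow> 'a \<Rightarrow> 'a ^ 'l"
  where "g_part f t = f (t, 0) - f (0, 0)"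

definition h_part :: "('a \<times> 'a \<Rightarrow> ('a :: finite_field) ^ 'l) \<Rightarrow> 'a \<Rightarrow> 'a ^ 'l"
  where "h_part f t = f (0, t) - f (0, 0)"

definition f_tilde :: "('a \<times> 'a \<Rightarrow> ('a :: finite_field) ^ 'l) \<Rightarrow> 'a \<times> 'a \<Rightarrow> 'a ^ 'l"
  where "f_tilde f = (\<lambda>(x, y). f (x, y) - g_part f y - h_part f x)"

definition f_zero :: "('a \<times> 'a \<Rightarrow> ('a :: finite_field) ^ 'l) \<Rightarrow> 'a \<times> 'a \<Rightarrow> 'a ^ 'l"
  where "f_zero f = (\<lambda>(x, y). f (x, y) - f (0, 0))"

definition f_tilde_zero :: "('a \<times> 'a \<Rightarrow> ('a :: finite_field) ^ 'l) \<Rightarrow> 'a \<times> 'a \<Rightarrow> 'a ^ 'l"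
  where "f_tilde_zero f = (\<lambda>(x, y). f_zero f (x, y) - g_part f y - h_part f x)"

text \<open>\<open>C\<close> is the one and only strong component of \<open>G\<close> containing the vertex \<open>x\<close>.\<close>

definition strong_component_at ::
    "('v, 'b) pre_digraph \<Rightarrow> 'v \<Rightarrow> ('v, 'b) pre_digraph \<Rightarrow> bool"
  where "strong_component_at G x C \<longleftrightarrow> {H \<in> pre_digraph.sccs G. x \<in> verts H} = {C}"

end

theory Submission
  imports Defs
begin

text \<open>
  Let \<open>W\<^sub>0\<close> be the span of the image of \<open>f_tilde_zero f\<close>, and write \<open>c\<close> for \<open>f (0, 0)\<close>.  Give each
  vertex \<open>(x, v)\<close> the level \<open>v - g x\<close>.  The definition of \<open>f_tilde_zero f\<close> gives
  \<open>f (x, y) = c + g y + h x + f_tilde_zero f (x, y)\<close>, and \<open>g x - h x = f_tilde_zero f (x, 0)\<close> lies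
  in \<open>W\<^sub>0\<close>; so the levels of the two ends of any arc add up to \<open>c\<close> modulo \<open>W\<^sub>0\<close>
  (\<open>level_arc\<close>).  Along a walk the class of the level modulo \<open>W\<^sub>0\<close> thus alternates between some \<open>t\<close>
  and \<open>c - t\<close>.  The theorem says that this is the only obstruction to reachability, and then counts
  the orbits of the reflection \<open>t \<mapsto> c - t\<close> on the quotient by \<open>W\<^sub>0\<close>.

  That there is no other obstruction rests on two observations.  First, every vertex has \<open>q\<close>
  out-neighbours and \<open>q\<close> in-neighbours, and in a finite digraph with balanced degrees reachability
  is symmetric (\<open>balanced_reachable_sym\<close>).  Arcs may therefore be traversed in both directions.
  Secondly, one step forwards and one step backwards through a vertex with first coordinate \<open>y\<close>
  lead from \<open>(x, v)\<close> to \<open>(z, v + f (z, y) - f (x, y))\<close>, and stepping the other way round leads to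
  \<open>(z, v + f (y, z) - f (y, x))\<close>.  Both displacements are independent of \<open>v\<close>.  The displacements
  by which one can return to the first coordinate 0 form an additive group, which is an
  \<open>F\<^sub>p\<close>-subspace because \<open>F\<^sub>p\<close> consists of multiples of 1; suitable combinations of such moves
  show that it contains every value of \<open>f_tilde_zero f\<close>, and hence all of \<open>W\<^sub>0\<close>
  (\<open>reachable_same_level\<close>).  So the strong components are the sets of vertices whose
  level is \<open>t\<close> or \<open>c - t\<close> modulo \<open>W\<^sub>0\<close> (\<open>reachable_iff_level\<close>).

  The vertices of one level class number \<open>q * card W\<^sub>0\<close>, so all counting follows by adding up the
  sizes of the components.  If \<open>q\<close> is odd, the reflection has exactly one fixed class, that of
  \<open>c / 2\<close>, giving one component of half the size of the others.  If \<open>q\<close> is even, the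
  reflection is the translation by \<open>c\<close>; either all classes are fixed or none is.

  The isomorphisms are translations of the vector coordinate.  Adding \<open>s\<close> at one end of an arc and
  \<open>-s\<close> at the other preserves the arc.  For even \<open>q\<close> these agree, and translation by \<open>s\<close> is an
  automorphism of the whole digraph.  For odd \<open>q\<close> a component with two distinct level classes is
  bipartite between them, so one class can be moved by \<open>s\<close> and the other by \<open>-s\<close>.  Translation by
  \<open>- c / 2\<close> takes the digraph of \<open>f\<close> to that of \<open>f_zero f\<close>, which has the same \<open>g\<close>, \<open>h\<close> and
  \<open>W\<^sub>0\<close> but \<open>c = 0\<close>; statements about \<open>D\<^sub>0\<close> are thus instances of those about \<open>D\<close>.
\<close>

section \<open>Reachability, components and isomorphisms of digraphs\<close>

text \<open>
  The set \<open>R\<close> of vertices reachable from \<open>v\<close> is left by no arc.  Since the degrees are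
  balanced, as many arcs end in \<open>R\<close> as start in \<open>R\<close>, so no arc enters \<open>R\<close> from outside either, and
  a vertex \<open>u\<close> that reaches \<open>v \<in> R\<close> must itself lie in \<open>R\<close>.
\<close>

lemma (in fin_digraph) balanced_reachable_sym:
  assumes balanced: "\<And>v. v \<in> verts G \<Longrightarrow> in_degree G v = out_degree G v"
    and "u \<rightarrow>\<^sup>* v"
  shows "v \<rightarrow>\<^sup>* u"
proof -
  define R where "R = {w. v \<rightarrow>\<^sup>* w}"
  have R_verts: "R \<subseteq> verts G"
    by (auto simp: R_def elim: reachable_in_vertsE)
  then have fin: "finite R"
    using finite_verts finite_subset by blast
  have "card (\<Union>r\<in>R. in_arcs G r) = (\<Sum>r\<in>R. in_degree G r)"
    unfolding in_degree_def by (rule card_UN_disjoint) (use fin in auto)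
  also have "\<dots> = (\<Sum>r\<in>R. out_degree G r)"
    using R_verts balanced by (intro sum.cong) auto
  also have "\<dots> = card (\<Union>r\<in>R. out_arcs G r)"
    unfolding out_degree_def by (rule card_UN_disjoint[symmetric]) (use fin in auto)
  finally have card_eq: "card (\<Union>r\<in>R. out_arcs G r) = card (\<Union>r\<in>R. in_arcs G r)" ..
  have "tail G a \<rightarrow> head G a" if "a \<in> arcs G" for a
    using that by (auto simp: arcs_ends_conv)
  then have "v \<rightarrow>\<^sup>* head G a" if "a \<in> arcs G" "v \<rightarrow>\<^sup>* tail G a" for a
    using that reachable_adj_trans by blast
  then have "(\<Union>r\<in>R. out_arcs G r) \<subseteq> (\<Union>r\<in>R. in_arcs G r)"
    by (auto simp: R_def)
  then have arcs_eq: "(\<Union>r\<in>R. out_arcs G r) = (\<Union>r\<in>R. in_arcs G r)"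
    by (intro card_subset_eq card_eq) (use fin in auto)
  have closed: "x \<in> R" if "x \<rightarrow> y" "y \<in> R" for x y
  proof -
    from \<open>x \<rightarrow> y\<close> obtain a where "a \<in> arcs G" "tail G a = x" "head G a = y" by blast
    with \<open>y \<in> R\<close> have "a \<in> (\<Union>r\<in>R. in_arcs G r)" by auto
    with arcs_eq \<open>tail G a = x\<close> show ?thesis by auto
  qed
  from \<open>u \<rightarrow>\<^sup>* v\<close> have "u \<in> R"
    by (induction rule: converse_reachable_induct) (auto simp: R_def intro: closed[unfolded R_def, simplified])
  then show ?thesis by (simp add: R_def)
qed

text \<open>
  When arcs are pairs of vertices, a bijection of the vertices determines the map on arcs.
\<close>

lemma digraph_isoI_bij:
  assumes "wf_digraph G" "wf_digraph H"
    and ends: "tail G = fst" "head G = snd" "tail H = fst" "head H = snd"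
    and bij: "bij_betw \<phi> (verts G) (verts H)"
    and arcs: "\<And>u v. u \<in> verts G \<Longrightarrow> v \<in> verts G \<Longrightarrow>
                 (u, v) \<in> arcs G \<longleftrightarrow> (\<phi> u, \<phi> v) \<in> arcs H"
  shows "digraph_iso G H"
proof -
  interpret G: wf_digraph G by fact
  interpret H: wf_digraph H by fact
  have arcs_verts: "u \<in> verts G \<and> v \<in> verts G" if "(u, v) \<in> arcs G" for u v
    using G.tail_in_verts[OF that] G.head_in_verts[OF that] ends by simp
  have arcs_verts': "u \<in> verts H \<and> v \<in> verts H" if "(u, v) \<in> arcs H" for u v
    using H.tail_in_verts[OF that] H.head_in_verts[OF that] ends by simp
  define hom where "hom = \<lparr>iso_verts = \<phi>, iso_arcs = map_prod \<phi> \<phi>, iso_head = snd, iso_tail = fst\<rparr>"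
  have inj: "inj_on \<phi> (verts G)" and img: "\<phi> ` verts G = verts H"
    using bij by (auto simp: bij_betw_def)
  have "inj_on (map_prod \<phi> \<phi>) (arcs G)"
    by (rule inj_on_subset[OF map_prod_inj_on[OF inj inj]]) (use arcs_verts in auto)
  then have "G.digraph_isomorphism hom"
    by (auto simp: G.digraph_isomorphism_def hom_def inj ends \<open>wf_digraph G\<close>)
  moreover have "map_prod \<phi> \<phi> ` arcs G = arcs H"
  proof (intro equalityI subsetI)
    fix a assume "a \<in> map_prod \<phi> \<phi> ` arcs G"
    then obtain u v where "(u, v) \<in> arcs G" "a = (\<phi> u, \<phi> v)" by auto
    then show "a \<in> arcs H" using arcs arcs_verts by blast
  next
    fix a assume a: "a \<in> arcs H"
    obtain u' v' where a': "a = (u', v')" by (cases a)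
    with a arcs_verts' img obtain u v where "u \<in> verts G" "v \<in> verts G" "u' = \<phi> u" "v' = \<phi> v"
      by blast
    with a a' arcs[of u v] show "a \<in> map_prod \<phi> \<phi> ` arcs G"
      by (auto intro: rev_image_eqI[of "(u, v)"])
  qed
  then have "H = app_iso hom G"
    by (intro pre_digraph.equality) (simp_all add: hom_def ends img)
  ultimately show ?thesis by (auto simp: digraph_iso_def)
qed

lemma strong_component_at_scc_of:
  assumes "wf_digraph G" "u \<in> verts G"
  shows "strong_component_at G u (G \<restriction> pre_digraph.scc_of G u)"
proof -
  interpret wf_digraph G by fact
  have "scc_of u \<in> sccs_verts" using assms by (simp add: scc_of_in_sccs_verts)
  then have in_sccs: "G \<restriction> scc_of u \<in> sccs" by (rule in_verts_sccsD_sccs)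
  have self: "u \<in> scc_of u" using assms by (simp add: in_scc_of_self)
  have uniq: "H = G \<restriction> scc_of u" if "H \<in> sccs" "u \<in> verts H" for H
  proof (rule ccontr)
    assume "H \<noteq> G \<restriction> scc_of u"
    then have "verts H \<inter> verts (G \<restriction> scc_of u) = {}"
      by (rule scc_disj[OF that(1) in_sccs])
    with that(2) self show False by auto
  qed
  have "u \<in> verts (G \<restriction> scc_of u)"
    using self by (simp only: induce_subgraph_verts)
  with in_sccs uniq have "{H \<in> sccs. u \<in> verts H} = {G \<restriction> scc_of u}"
    by blast
  then show ?thesis
    by (simp only: strong_component_at_def)
qed

lemma sccs_conv_scc_of:
  assumes "wf_digraph G"
  shows "pre_digraph.sccs G = (\<lambda>u. G \<restriction> pre_digraph.scc_of G u) ` verts G"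
  using wf_digraph.sccs_conv_sccs_verts[OF assms] wf_digraph.sccs_verts_conv_scc_of[OF assms]
  by (simp add: image_image)

lemma (in fin_digraph) sum_card_sccs: "(\<Sum>C\<in>sccs. card (verts C)) = card (verts G)"
proof -
  have "(\<Sum>C\<in>sccs. card (verts C)) = sum card sccs_verts"
    unfolding sccs_verts_conv by (simp add: sum.reindex[OF inj_on_verts_sccs])
  also have "\<dots> = card (\<Union>sccs_verts)"
  proof (rule card_Union_disjoint[symmetric])
    show "pairwise disjnt sccs_verts"
      by (auto simp: pairwise_def disjnt_def dest: sccs_verts_disjoint)
    show "finite S" if "S \<in> sccs_verts" for S
      using sccs_verts_subsets[OF that] finite_verts finite_subset by blast
  qed
  also have "\<Union>sccs_verts = verts G"
    using sccs_verts_subsets in_scc_of_self scc_of_in_sccs_verts by blast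
  finally show ?thesis .
qed

section \<open>Moves in the digraph of a function\<close>

lemma fdigraph_simps [simp]:
  "verts (fdigraph f) = UNIV"
  "((x, xs), (y, ys)) \<in> arcs (fdigraph f) \<longleftrightarrow> xs + ys = f (x, y)"
  "((x, xs), (y, ys)) \<in> arcs_ends (fdigraph f) \<longleftrightarrow> xs + ys = f (x, y)"
  "tail (fdigraph f) = fst"
  "head (fdigraph f) = snd"
  by (auto simp: fdigraph_def vec_eq_iff)

lemma fin_digraph_fdigraph: "fin_digraph (fdigraph f)"
  by unfold_locales auto

lemma wf_digraph_fdigraph: "wf_digraph (fdigraph f)"
  by unfold_locales auto

lemma fdigraph_degrees:
  fixes f :: "'a \<times> 'a \<Rightarrow> ('a :: finite_field) ^ 'l"
  shows "in_degree (fdigraph f) v = CARD('a)" "out_degree (fdigraph f) v = CARD('a)"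
proof -
  obtain x xs where v: "v = (x, xs)" by (cases v)
  have "in_arcs (fdigraph f) v = range (\<lambda>y. ((y, f (y, x) - xs), v))"
    by (auto simp: in_arcs_def v eq_diff_eq)
  moreover have "inj (\<lambda>y. ((y, f (y, x) - xs), v))" by (auto simp: inj_on_def)
  ultimately show "in_degree (fdigraph f) v = CARD('a)"
    by (simp add: in_degree_def card_image)
  have "out_arcs (fdigraph f) v = range (\<lambda>y. (v, (y, f (x, y) - xs)))"
    by (auto simp: out_arcs_def v eq_diff_eq add.commute)
  moreover have "inj (\<lambda>y. (v, (y, f (x, y) - xs)))" by (auto simp: inj_on_def)
  ultimately show "out_degree (fdigraph f) v = CARD('a)"
    by (simp add: out_degree_def card_image)
qed

lemma fdigraph_reachable_sym:
  "u \<rightarrow>\<^sup>*\<^bsub>fdigraph f\<^esub> v \<Longrightarrow> v \<rightarrow>\<^sup>*\<^bsub>fdigraph f\<^esub> u"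
  by (rule fin_digraph.balanced_reachable_sym[OF fin_digraph_fdigraph])
    (simp_all add: fdigraph_degrees)

lemma fdigraph_reachable_trans:
  "u \<rightarrow>\<^sup>*\<^bsub>fdigraph f\<^esub> v \<Longrightarrow> v \<rightarrow>\<^sup>*\<^bsub>fdigraph f\<^esub> w \<Longrightarrow> u \<rightarrow>\<^sup>*\<^bsub>fdigraph f\<^esub> w"
  by (rule wf_digraph.reachable_trans[OF wf_digraph_fdigraph])

lemma fdigraph_reachable_arc:
  "xs + ys = f (x, y) \<Longrightarrow> (x, xs) \<rightarrow>\<^sup>*\<^bsub>fdigraph f\<^esub> (y, ys)"
  by (rule wf_digraph.reachable_adjI[OF wf_digraph_fdigraph]) simp

text \<open>
  Both vertices are joined to a common neighbour with first coordinate \<open>y\<close>: a common out-neighbour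
  in the first case and a common in-neighbour in the second.
\<close>

lemma fdigraph_reachable_two_steps:
  shows "(x, xs) \<rightarrow>\<^sup>*\<^bsub>fdigraph f\<^esub> (z, xs + f (z, y) - f (x, y))"
    and "(x, xs) \<rightarrow>\<^sup>*\<^bsub>fdigraph f\<^esub> (z, xs + f (y, z) - f (y, x))"
proof -
  have "(x, xs) \<rightarrow>\<^sup>*\<^bsub>fdigraph f\<^esub> (y, f (x, y) - xs)"
    by (rule fdigraph_reachable_arc) simp
  moreover have "(z, xs + f (z, y) - f (x, y)) \<rightarrow>\<^sup>*\<^bsub>fdigraph f\<^esub> (y, f (x, y) - xs)"
    by (rule fdigraph_reachable_arc) simp
  ultimately show "(x, xs) \<rightarrow>\<^sup>*\<^bsub>fdigraph f\<^esub> (z, xs + f (z, y) - f (x, y))"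
    using fdigraph_reachable_sym fdigraph_reachable_trans by blast
  have "(y, f (y, x) - xs) \<rightarrow>\<^sup>*\<^bsub>fdigraph f\<^esub> (x, xs)"
    by (rule fdigraph_reachable_arc) simp
  moreover have "(y, f (y, x) - xs) \<rightarrow>\<^sup>*\<^bsub>fdigraph f\<^esub> (z, xs + f (y, z) - f (y, x))"
    by (rule fdigraph_reachable_arc) simp
  ultimately show "(x, xs) \<rightarrow>\<^sup>*\<^bsub>fdigraph f\<^esub> (z, xs + f (y, z) - f (y, x))"
    using fdigraph_reachable_sym fdigraph_reachable_trans by blast
qed

section \<open>Subspaces over the prime field\<close>

text \<open>
  Scalars from the prime field are multiples of 1, so scaling is iterated addition.
\<close>

lemma Fp_subspaceI_additive:
  fixes S :: "(('a :: finite_field) ^ 'l) set"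
  assumes "0 \<in> S" and add: "\<And>v w. v \<in> S \<Longrightarrow> w \<in> S \<Longrightarrow> v + w \<in> S"
  shows "Fp.subspace S"
proof (rule Fp.subspaceI)
  fix c :: "'a ring_char mod_ring" and v :: "'a ^ 'l"
  assume "v \<in> S"
  have "of_nat n *s v \<in> S" for n
    by (induction n) (auto simp: \<open>0 \<in> S\<close> vector_sadd_rdistrib \<open>v \<in> S\<close> intro!: add)
  moreover have "to_int_mod_ring c \<ge> 0"
    using range_to_int_mod_ring[where 'a = "'a ring_char"] by force
  then have "of_int (to_int_mod_ring c) = (of_nat (nat (to_int_mod_ring c)) :: 'a)"
    by simp
  ultimately show "prime_field_scale c v \<in> S"
    by (metis prime_field_scale_def)
qed (use assms in auto)

text \<open>
  Adding a vector \<open>b\<close> outside the span of \<open>B\<close> makes the span the disjoint union of the translates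
  of \<open>span B\<close> by the multiples of \<open>b\<close>.
\<close>

lemma card_Fp_span_independent:
  fixes B :: "(('a :: finite_field) ^ 'l) set"
  assumes "\<not> Fp.dependent B"
  shows "card (Fp.span B) = CARD('a ring_char mod_ring) ^ card B"
proof -
  have "finite B" by simp
  then show ?thesis using assms
  proof induction
    case (insert b B)
    have ind: "\<not> Fp.dependent B" "b \<notin> Fp.span B"
      using insert Fp.independent_insert by metis+
    define T where "T = (\<lambda>(k, v). prime_field_scale k b + v) ` ((UNIV :: 'a ring_char mod_ring set) \<times> Fp.span B)"
    have "inj_on (\<lambda>(k, v). prime_field_scale k b + v) ((UNIV :: 'a ring_char mod_ring set) \<times> Fp.span B)"
    proof (rule inj_onI, clarify)
      fix j k :: "'a ring_char mod_ring" and v w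
      assume vw: "v \<in> Fp.span B" "w \<in> Fp.span B"
        and eq: "prime_field_scale j b + v = prime_field_scale k b + w"
      have "prime_field_scale (j - k) b = w - v"
        using eq by (simp add: Fp.scale_left_diff_distrib algebra_simps)
      then have *: "prime_field_scale (j - k) b \<in> Fp.span B"
        using vw by (simp add: Fp.span_diff)
      have "j = k"
      proof (rule ccontr)
        assume "j \<noteq> k"
        then have "b = prime_field_scale (inverse (j - k)) (prime_field_scale (j - k) b)" by simp
        also have "\<dots> \<in> Fp.span B" using * by (rule Fp.span_scale)
        finally show False using ind by blast
      qed
      then show "j = k \<and> v = w" using eq by simp
    qed
    then have "card T = CARD('a ring_char mod_ring) * card (Fp.span B)"
      by (simp add: T_def card_image card_cartesian_product)
    moreover have "T = Fp.span (insert b B)"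
    proof (intro equalityI subsetI)
      fix x assume "x \<in> T"
      then obtain k v where "x = prime_field_scale k b + v" "v \<in> Fp.span B"
        unfolding T_def by auto
      then have "x - prime_field_scale k b \<in> Fp.span B" by simp
      then show "x \<in> Fp.span (insert b B)"
        unfolding Fp.span_insert by blast
    next
      fix x assume "x \<in> Fp.span (insert b B)"
      then obtain k where "x - prime_field_scale k b \<in> Fp.span B"
        unfolding Fp.span_insert by blast
      then show "x \<in> T"
        unfolding T_def by (intro image_eqI[of _ _ "(k, x - prime_field_scale k b)"]) auto
    qed
    ultimately show ?case using insert ind by simp
  qed simp
qed

lemma card_Fp_subspace:
  fixes S :: "(('a :: finite_field) ^ 'l) set"
  assumes "Fp.subspace S"
  shows "card S = CARD('a ring_char mod_ring) ^ Fp.dim S"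
proof -
  obtain B where B: "B \<subseteq> S" "\<not> Fp.dependent B" "S \<subseteq> Fp.span B" "card B = Fp.dim S"
    using Fp.basis_exists by blast
  with assms have "Fp.span B = S" by (simp add: Fp.span_minimal subset_antisym)
  with card_Fp_span_independent[OF B(2)] B(4) show ?thesis by simp
qed

lemma CHAR_eq_of_CARD:
  assumes "prime p" "CARD('a :: finite_field) = p ^ e"
  shows "CHAR('a) = p"
  using CARD_prime_field[OF assms] by simp

lemma Fp_subspace_of_nat_scale:
  assumes "Fp.subspace S" "v \<in> S"
  shows "of_nat n *s v \<in> S"
  using assms by (induction n) (auto simp: vector_sadd_rdistrib Fp.subspace_0 intro: Fp.subspace_add)

text \<open>
  If the characteristic is \<open>2 * n + 1\<close>, then \<open>n * (v + v) = - v\<close>.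
\<close>

lemma Fp_subspace_half:
  fixes S :: "(('a :: finite_field) ^ 'l) set"
  assumes "Fp.subspace S" "odd CHAR('a)" "v + v \<in> S"
  shows "v \<in> S"
proof -
  obtain n where "CHAR('a) = 2 * n + 1" using assms(2) by (auto elim: oddE)
  then have "(of_nat (n + n + 1) :: 'a) = 0" by (metis of_nat_CHAR mult_2)
  then have n: "(of_nat n + of_nat n :: 'a) = - 1"
    by (simp only: eq_neg_iff_add_eq_0 of_nat_add of_nat_1)
  have "of_nat n *s (v + v) = (of_nat n + of_nat n) *s v"
    by (simp only: vector_sadd_rdistrib vector_add_ldistrib)
  also have "\<dots> = - v" by (simp add: n vec_eq_iff)
  finally have "- v \<in> S" using Fp_subspace_of_nat_scale[OF assms(1,3)] by metis
  then show ?thesis using Fp.subspace_neg[OF assms(1)] by force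
qed

lemma CHAR_2_vec_double:
  fixes v :: "('a :: finite_field) ^ 'l"
  assumes "CHAR('a) = 2"
  shows "v + v = 0" "- v = v"
proof -
  have "(2 :: 'a) = 0" using of_nat_CHAR[where 'a = 'a] assms by simp
  then have "(x :: 'a) + x = 0" for x by (metis mult_2 mult_zero_left)
  then show "v + v = 0" by (simp add: vec_eq_iff)
  then show "- v = v" by (simp add: neg_eq_iff_add_eq_0)
qed

lemma exists_half:
  fixes v :: "('a :: finite_field) ^ 'l"
  assumes "odd CHAR('a)"
  obtains r where "r + r = v"
proof
  have "\<not> CHAR('a) dvd 2"
    using assms prime_CHAR_semidom[where 'a = 'a] CHAR_pos
    by (metis dvd_refl primes_dvd_imp_eq two_is_prime_nat finite_imp_CHAR_pos finite_UNIV)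
  then have "(2 :: 'a) \<noteq> 0"
    using of_nat_eq_0_iff_char_dvd[of 2, where 'a = 'a] by simp
  then show "inverse 2 *s v + inverse 2 *s v = v"
    by (simp add: vec_eq_iff flip: mult_2)
qed

section \<open>Levels and reachability\<close>

definition tilde_span :: "('a \<times> 'a \<Rightarrow> ('a :: finite_field) ^ 'l) \<Rightarrow> ('a ^ 'l) set"
  where "tilde_span f = Fp.span (range (f_tilde_zero f))"

text \<open>
  Using \<open>h_part\<close> in place of \<open>g_part\<close> would change levels only by elements of \<open>tilde_span f\<close>
  (\<open>g_minus_h_in_tilde_span\<close>).
\<close>

definition level :: "('a \<times> 'a \<Rightarrow> ('a :: finite_field) ^ 'l) \<Rightarrow> 'a \<times> ('a ^ 'l) \<Rightarrow> 'a ^ 'l"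
  where "level f z = snd z - g_part f (fst z)"

lemma level_Pair [simp]: "level f (x, xs) = xs - g_part f x"
  by (simp add: level_def)

lemma subspace_tilde_span: "Fp.subspace (tilde_span f)"
  by (simp add: tilde_span_def)

lemmas tilde_span_add = Fp.subspace_add[OF subspace_tilde_span]
  and tilde_span_diff = Fp.subspace_diff[OF subspace_tilde_span]
  and tilde_span_neg = Fp.subspace_neg[OF subspace_tilde_span]
  and tilde_span_0 [simp] = Fp.subspace_0[OF subspace_tilde_span]

lemma f_tilde_zero_in_tilde_span: "f_tilde_zero f z \<in> tilde_span f"
  by (auto simp: tilde_span_def intro: Fp.span_base)

lemma f_tilde_zero_eq: "f_tilde_zero f (x, y) = f (x, y) - f (0, 0) - g_part f y - h_part f x"
  by (simp add: f_tilde_zero_def f_zero_def)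

lemma parts_at_0 [simp]: "g_part f 0 = 0" "h_part f 0 = 0"
  by (simp_all add: g_part_def h_part_def)

lemma g_minus_h_in_tilde_span: "g_part f x - h_part f x \<in> tilde_span f"
  using f_tilde_zero_in_tilde_span[of f "(x, 0)"] by (simp add: f_tilde_zero_eq g_part_def)

text \<open>
  The invariant of walks: one step takes level \<open>t\<close> to \<open>f (0, 0) - t\<close> modulo \<open>tilde_span f\<close>.
\<close>

lemma level_arc:
  assumes "xs + ys = f (x, y)"
  shows "level f (x, xs) + level f (y, ys) - f (0, 0) \<in> tilde_span f"
proof -
  have "level f (x, xs) + level f (y, ys) - f (0, 0)
      = f_tilde_zero f (x, y) - (g_part f x - h_part f x)"
    using assms by (simp add: f_tilde_zero_eq algebra_simps)
  then show ?thesis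
    by (simp only: tilde_span_diff f_tilde_zero_in_tilde_span g_minus_h_in_tilde_span)
qed

text \<open>
  The displacements \<open>w\<close> that can always be realised above the first coordinate 0 form an additive
  group \<open>U\<close>, so it suffices to find the generators \<open>f_tilde_zero f (z, y)\<close> of \<open>tilde_span f\<close> in
  \<open>U\<close>.  Excursions from 0 to \<open>z\<close> and back, each consisting of two of the double steps above, give
  \<open>g z - h z\<close> and \<open>f (z, y) - f (0, y) - g z\<close>, of which the generators are combinations.
\<close>

lemma reachable_same_level:
  assumes "w \<in> tilde_span f"
  shows "(0, xs) \<rightarrow>\<^sup>*\<^bsub>fdigraph f\<^esub> (0, xs + w)"
proof -
  note [trans] = fdigraph_reachable_trans
  define U where "U = {w. \<forall>xs. (0, xs) \<rightarrow>\<^sup>*\<^bsub>fdigraph f\<^esub> (0, xs + w)}"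
  have U_add: "v + w \<in> U" if "v \<in> U" "w \<in> U" for v w
    using that unfolding U_def by (auto simp: add.assoc[symmetric] intro: fdigraph_reachable_trans)
  have U_0: "0 \<in> U"
    unfolding U_def using wf_digraph.reachable_refl[OF wf_digraph_fdigraph] by auto
  have U_sub: "Fp.subspace U" by (rule Fp_subspaceI_additive) (use U_0 U_add in auto)
  have gh: "g_part f z - h_part f z \<in> U" for z
    unfolding U_def
  proof (intro CollectI allI)
    fix xs
    have "(0, xs) \<rightarrow>\<^sup>*\<^bsub>fdigraph f\<^esub> (z, xs + f (z, 0) - f (0, 0))"
      by (rule fdigraph_reachable_two_steps)
    also have "\<dots> \<rightarrow>\<^sup>*\<^bsub>fdigraph f\<^esub>
        (0, (xs + f (z, 0) - f (0, 0)) + f (0, 0) - f (0, z))"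
      by (rule fdigraph_reachable_two_steps)
    finally show "(0, xs) \<rightarrow>\<^sup>*\<^bsub>fdigraph f\<^esub> (0, xs + (g_part f z - h_part f z))"
      by (simp add: g_part_def h_part_def algebra_simps)
  qed
  have fg: "f (z, y) - f (0, y) - g_part f z \<in> U" for z y
    unfolding U_def
  proof (intro CollectI allI)
    fix xs
    have "(0, xs) \<rightarrow>\<^sup>*\<^bsub>fdigraph f\<^esub> (z, xs + f (z, y) - f (0, y))"
      by (rule fdigraph_reachable_two_steps)
    also have "\<dots> \<rightarrow>\<^sup>*\<^bsub>fdigraph f\<^esub>
        (0, (xs + f (z, y) - f (0, y)) + f (0, 0) - f (z, 0))"
      by (rule fdigraph_reachable_two_steps)
    finally
    show "(0, xs) \<rightarrow>\<^sup>*\<^bsub>fdigraph f\<^esub> (0, xs + (f (z, y) - f (0, y) - g_part f z))"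
      by (simp add: g_part_def algebra_simps)
  qed
  have "f_tilde_zero f (z, y) \<in> U" for z y
  proof -
    have "f_tilde_zero f (z, y) = (f (z, y) - f (0, y) - g_part f z)
        + (g_part f z - h_part f z) - (g_part f y - h_part f y)"
      by (simp add: f_tilde_zero_eq h_part_def algebra_simps)
    then show ?thesis
      using Fp.subspace_diff[OF U_sub Fp.subspace_add[OF U_sub fg[of z y] gh[of z]] gh[of y]] by simp
  qed
  then have "tilde_span f \<subseteq> U"
    unfolding tilde_span_def by (intro Fp.span_minimal U_sub) auto
  with assms show ?thesis by (auto simp: U_def)
qed

text \<open>
  Every component meets the vertices with first coordinate 0, and there the level is the vector
  coordinate itself.
\<close>

lemma reachable_to_level:
  "z \<rightarrow>\<^sup>*\<^bsub>fdigraph f\<^esub> (0, level f z)"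
  using fdigraph_reachable_two_steps(1)[where x = "fst z" and xs = "snd z" and z = 0 and y = 0 and f = f]
  by (simp add: level_def g_part_def algebra_simps)

lemma reachable_level_complement:
  "(0, v) \<rightarrow>\<^sup>*\<^bsub>fdigraph f\<^esub> (0, f (0, 0) - v)"
  by (rule fdigraph_reachable_arc) simp

text \<open>
  Forwards, each arc of a walk exchanges the two alternatives.  Backwards, both vertices are moved
  to first coordinate 0, where the displacement lies in \<open>tilde_span f\<close>, after one application of
  the reflection in the second alternative.
\<close>

lemma reachable_iff_level:
  "z \<rightarrow>\<^sup>*\<^bsub>fdigraph f\<^esub> z' \<longleftrightarrow>
     level f z' - level f z \<in> tilde_span f \<or> level f z' + level f z - f (0, 0) \<in> tilde_span f"
proof
  assume "z \<rightarrow>\<^sup>*\<^bsub>fdigraph f\<^esub> z'"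
  then show "level f z' - level f z \<in> tilde_span f \<or> level f z' + level f z - f (0, 0) \<in> tilde_span f"
  proof (induction rule: wf_digraph.reachable_induct[OF wf_digraph_fdigraph, consumes 1, case_names base step])
    case (step a b)
    obtain x xs y ys where ab: "a = (x, xs)" "b = (y, ys)" by (cases a, cases b)
    with step(2) have arc: "level f a + level f b - f (0, 0) \<in> tilde_span f"
      using level_arc[of xs ys f x y] by simp
    from step(3) show ?case
    proof
      assume "level f a - level f z \<in> tilde_span f"
      from tilde_span_diff[OF arc this] show ?thesis by (simp add: algebra_simps)
    next
      assume "level f a + level f z - f (0, 0) \<in> tilde_span f"
      from tilde_span_diff[OF arc this] show ?thesis by (simp add: algebra_simps)
    qed
  qed simp
next
  note [trans] = fdigraph_reachable_trans
  have from_level: "(0, level f z') \<rightarrow>\<^sup>*\<^bsub>fdigraph f\<^esub> z'"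
    by (rule fdigraph_reachable_sym[OF reachable_to_level])
  assume "level f z' - level f z \<in> tilde_span f \<or> level f z' + level f z - f (0, 0) \<in> tilde_span f"
  then show "z \<rightarrow>\<^sup>*\<^bsub>fdigraph f\<^esub> z'"
  proof
    assume *: "level f z' - level f z \<in> tilde_span f"
    have "z \<rightarrow>\<^sup>*\<^bsub>fdigraph f\<^esub> (0, level f z)"
      by (rule reachable_to_level)
    also have "(0, level f z) \<rightarrow>\<^sup>*\<^bsub>fdigraph f\<^esub> (0, level f z')"
      using reachable_same_level[OF *, of "level f z"] by simp
    also note from_level
    finally show ?thesis .
  next
    assume *: "level f z' + level f z - f (0, 0) \<in> tilde_span f"
    have "z \<rightarrow>\<^sup>*\<^bsub>fdigraph f\<^esub> (0, level f z)"
      by (rule reachable_to_level)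
    also have "(0, level f z) \<rightarrow>\<^sup>*\<^bsub>fdigraph f\<^esub> (0, f (0, 0) - level f z)"
      by (rule reachable_level_complement)
    also have "(0, f (0, 0) - level f z) \<rightarrow>\<^sup>*\<^bsub>fdigraph f\<^esub> (0, level f z')"
      using reachable_same_level[OF *, of "f (0, 0) - level f z"] by simp
    also note from_level
    finally show ?thesis .
  qed
qed

lemma scc_of_fdigraph:
  "pre_digraph.scc_of (fdigraph f) z =
     {z'. level f z' - level f z \<in> tilde_span f} \<union>
     {z'. level f z' + level f z - f (0, 0) \<in> tilde_span f}"
proof -
  have "pre_digraph.scc_of (fdigraph f) z = {z'. z \<rightarrow>\<^sup>*\<^bsub>fdigraph f\<^esub> z'}"
    unfolding pre_digraph.scc_of_def using fdigraph_reachable_sym[where f = f] by blast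
  then show ?thesis by (auto simp: reachable_iff_level)
qed

lemma finite_sccs_fdigraph [simp]: "finite (pre_digraph.sccs (fdigraph f))"
  by (simp add: sccs_conv_scc_of wf_digraph_fdigraph)

section \<open>Sizes of the components\<close>

lemma card_level_coset:
  fixes f :: "'a \<times> 'a \<Rightarrow> ('a :: finite_field) ^ 'l"
  shows "card {z. level f z - t \<in> tilde_span f} = CARD('a) * card (tilde_span f)"
proof -
  have "bij_betw (\<lambda>(a, w). (a, w + t + g_part f a)) (UNIV \<times> tilde_span f)
          {z. level f z - t \<in> tilde_span f}"
    by (rule bij_betwI[of _ _ _ "\<lambda>z. (fst z, level f z - t)"]) (auto simp: level_def)
  from bij_betw_same_card[OF this, symmetric] show ?thesis
    by (simp add: card_cartesian_product)
qed

text \<open>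
  The theorem describes a component by \<open>h_part\<close>, whereas levels are defined by \<open>g_part\<close>; the
  difference is absorbed by \<open>tilde_span f\<close>.
\<close>

lemma level_vertex_sets:
  "{(a, v + h_part f a - g_part f u + w) | a w. w \<in> tilde_span f}
     = {z. level f z - level f (u, v) \<in> tilde_span f}" (is "?A1 = ?B1")
  "{(b, - v + h_part f b + g_part f u + f (0, 0) + w) | b w. w \<in> tilde_span f}
     = {z. level f z + level f (u, v) - f (0, 0) \<in> tilde_span f}" (is "?A2 = ?B2")
proof -
  have eq: "{(a, k + h_part f a + w) | a w. w \<in> tilde_span f} = {z. level f z - k \<in> tilde_span f}" for k
  proof (intro equalityI subsetI)
    fix z assume "z \<in> {(a, k + h_part f a + w) | a w. w \<in> tilde_span f}"
    then obtain a w where "z = (a, k + h_part f a + w)" "w \<in> tilde_span f" by blast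
    with tilde_span_diff[OF this(2) g_minus_h_in_tilde_span[of f a]]
    show "z \<in> {z. level f z - k \<in> tilde_span f}" by (simp add: algebra_simps)
  next
    fix z assume z: "z \<in> {z. level f z - k \<in> tilde_span f}"
    obtain a xs where [simp]: "z = (a, xs)" by (cases z)
    from z have "xs - g_part f a - k \<in> tilde_span f" by simp
    from tilde_span_add[OF this g_minus_h_in_tilde_span[of f a]]
    have "xs - h_part f a - k \<in> tilde_span f" by (simp add: algebra_simps)
    moreover have "z = (a, k + h_part f a + (xs - h_part f a - k))" by simp
    ultimately show "z \<in> {(a, k + h_part f a + w) | a w. w \<in> tilde_span f}" by blast
  qed
  show "?A1 = ?B1" using eq[of "v - g_part f u"] by (simp add: algebra_simps)
  show "?A2 = ?B2" using eq[of "f (0, 0) - v + g_part f u"] by (simp add: algebra_simps)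
qed

text \<open>
  The two level classes of the component of \<open>z\<close> coincide if twice the level of \<open>z\<close> is \<open>f (0, 0)\<close>
  modulo \<open>tilde_span f\<close>, and are disjoint otherwise.
\<close>

lemma card_scc_of_fdigraph:
  fixes f :: "'a \<times> 'a \<Rightarrow> ('a :: finite_field) ^ 'l"
  shows "card (pre_digraph.scc_of (fdigraph f) z) =
    (if level f z + level f z - f (0, 0) \<in> tilde_span f then 1 else 2) * (CARD('a) * card (tilde_span f))"
proof -
  define A where "A = {z'. level f z' - level f z \<in> tilde_span f}"
  define B where "B = {z'. level f z' - (f (0, 0) - level f z) \<in> tilde_span f}"
  have scc: "pre_digraph.scc_of (fdigraph f) z = A \<union> B"
    unfolding scc_of_fdigraph A_def B_def by (simp add: algebra_simps)
  have cards: "card A = CARD('a) * card (tilde_span f)" "card B = CARD('a) * card (tilde_span f)"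
    unfolding A_def B_def by (rule card_level_coset)+
  show ?thesis
  proof (cases "level f z + level f z - f (0, 0) \<in> tilde_span f")
    case True
    have "level f z' - level f z \<in> tilde_span f \<longleftrightarrow>
        level f z' - (f (0, 0) - level f z) \<in> tilde_span f" for z'
    proof
      assume "level f z' - level f z \<in> tilde_span f"
      from tilde_span_add[OF this True] show "level f z' - (f (0, 0) - level f z) \<in> tilde_span f"
        by (simp add: algebra_simps)
    next
      assume "level f z' - (f (0, 0) - level f z) \<in> tilde_span f"
      from tilde_span_diff[OF this True] show "level f z' - level f z \<in> tilde_span f"
        by (simp add: algebra_simps)
    qed
    then have "A = B" by (simp add: A_def B_def)
    with True scc cards show ?thesis by simp
  next
    case False
    have "A \<inter> B = {}"
    proof (rule ccontr)
      assume "A \<inter> B \<noteq> {}"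
      then obtain z' where "level f z' - (f (0, 0) - level f z) \<in> tilde_span f"
          "level f z' - level f z \<in> tilde_span f"
        by (auto simp: A_def B_def)
      from tilde_span_diff[OF this] have "level f z + level f z - f (0, 0) \<in> tilde_span f"
        by simp
      with False show False by simp
    qed
    with False scc cards show ?thesis by (simp add: card_Un_disjoint)
  qed
qed

section \<open>Isomorphisms by translation\<close>

lemma arcs_fdigraph_iff:
  "(a, b) \<in> arcs (fdigraph f) \<longleftrightarrow> snd a + snd b = f (fst a, fst b)"
  by (cases a; cases b) simp

text \<open>
  Makes a component with two distinct level classes bipartite.
\<close>

lemma no_arc_within_half:
  assumes t: "t + t - f (0, 0) \<notin> tilde_span f"
    and "level f a - t \<in> tilde_span f" "level f b - t \<in> tilde_span f"
  shows "(a, b) \<notin> arcs (fdigraph f)"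
proof
  assume "(a, b) \<in> arcs (fdigraph f)"
  then have "level f a + level f b - f (0, 0) \<in> tilde_span f"
    using level_arc[where xs = "snd a" and ys = "snd b" and x = "fst a" and y = "fst b" and f = f]
    by (simp add: arcs_fdigraph_iff)
  from tilde_span_diff[OF tilde_span_diff[OF this assms(2)] assms(3)] have "t + t - f (0, 0) \<in> tilde_span f"
    by (simp add: algebra_simps)
  with t show False by simp
qed

lemma arcs_induce_subgraph_iff:
  assumes "u \<in> S" "v \<in> S"
  shows "(u, v) \<in> arcs (fdigraph f \<restriction> S) \<longleftrightarrow> (u, v) \<in> arcs (fdigraph f)"
  using assms by simp

lemma wf_digraph_induce_fdigraph: "wf_digraph (fdigraph f \<restriction> S)"
  by unfold_locales auto

definition translate :: "'a \<Rightarrow> 'b \<times> 'a \<Rightarrow> 'b \<times> ('a :: ab_group_add)"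
  where "translate s z = (fst z, snd z + s)"

lemma translate_simps [simp]:
  "fst (translate s z) = fst z" "snd (translate s z) = snd z + s"
  "translate (- s) (translate s z) = z" "translate s (translate (- s) z) = z"
  by (simp_all add: translate_def)

lemma level_translate: "level f (translate s z) = level f z + s"
  by (simp add: level_def)

text \<open>
  The level class of \<open>z\<close> is moved by \<open>s\<close>, the difference of the levels of \<open>z'\<close> and \<open>z\<close>, and the
  opposite class by \<open>-s\<close>.  Arcs run between opposite classes, where the shifts cancel in the sum
  that defines adjacency.  The construction needs both components to have two distinct
  classes, since otherwise the two shifts would compete on the same vertices.
\<close>

lemma digraph_iso_sccs_two_halves:
  assumes z: "level f z + level f z - f (0, 0) \<notin> tilde_span f"
    and z': "level f z' + level f z' - f (0, 0) \<notin> tilde_span f"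
  shows "digraph_iso (fdigraph f \<restriction> pre_digraph.scc_of (fdigraph f) z)
                     (fdigraph f \<restriction> pre_digraph.scc_of (fdigraph f) z')"
proof -
  define t t' s where "t = level f z" and "t' = level f z'" and "s = t' - t"
  have t: "t + t - f (0, 0) \<notin> tilde_span f" and t': "t' + t' - f (0, 0) \<notin> tilde_span f"
    using z z' by (simp_all add: t_def t'_def)
  have compl: "(f (0, 0) - k) + (f (0, 0) - k) - f (0, 0) \<notin> tilde_span f"
    if k: "k + k - f (0, 0) \<notin> tilde_span f" for k
  proof
    assume "(f (0, 0) - k) + (f (0, 0) - k) - f (0, 0) \<in> tilde_span f"
    from tilde_span_neg[OF this] k show False by (simp add: algebra_simps)
  qed
  have not_both: "\<not> (level f a - k \<in> tilde_span f \<and> level f a - (f (0, 0) - k) \<in> tilde_span f)"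
    if k: "k + k - f (0, 0) \<notin> tilde_span f" for k a
  proof
    assume *: "level f a - k \<in> tilde_span f \<and> level f a - (f (0, 0) - k) \<in> tilde_span f"
    have "k + k - f (0, 0) = (level f a - (f (0, 0) - k)) - (level f a - k)" by simp
    with k tilde_span_diff[OF conjunct2[OF *] conjunct1[OF *]] show False by metis
  qed
  define S S' where "S = pre_digraph.scc_of (fdigraph f) z" and "S' = pre_digraph.scc_of (fdigraph f) z'"
  have S_iff: "a \<in> S \<longleftrightarrow> level f a - t \<in> tilde_span f \<or> level f a - (f (0, 0) - t) \<in> tilde_span f" for a
    by (simp add: S_def scc_of_fdigraph t_def diff_diff_eq2 add.commute)
  have S'_iff: "a \<in> S' \<longleftrightarrow> level f a - t' \<in> tilde_span f \<or> level f a - (f (0, 0) - t') \<in> tilde_span f" for a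
    by (simp add: S'_def scc_of_fdigraph t'_def diff_diff_eq2 add.commute)
  define \<phi> where "\<phi> a = (if level f a - t \<in> tilde_span f then translate s a else translate (- s) a)" for a
  define \<psi> where "\<psi> a = (if level f a - t' \<in> tilde_span f then translate (- s) a else translate s a)" for a
  have fwd1: "level f (translate s a) - t' = level f a - t"
    and fwd2: "level f (translate (- s) a) - (f (0, 0) - t') = level f a - (f (0, 0) - t)"
    and bwd1: "level f (translate (- s) a) - t = level f a - t'"
    and bwd2: "level f (translate s a) - (f (0, 0) - t) = level f a - (f (0, 0) - t')" for a
    by (simp_all add: level_translate s_def)
  note steps = fwd1 fwd2 bwd1 bwd2
  \<comment> \<open>\<open>t'\<close> and \<open>f (0, 0) - t'\<close> are different classes, so \<open>\<psi>\<close> recognises how \<open>\<phi>\<close> moved a vertex.\<close>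
  have "bij_betw \<phi> S S'"
  proof (rule bij_betwI[of _ _ _ \<psi>])
    show "\<phi> \<in> S \<rightarrow> S'" by (auto simp: S_iff S'_iff \<phi>_def steps simp del: translate_simps)
    show "\<psi> \<in> S' \<rightarrow> S" by (auto simp: S_iff S'_iff \<psi>_def steps simp del: translate_simps)
    show "\<psi> (\<phi> a) = a" if "a \<in> S" for a
    proof (cases "level f a - t \<in> tilde_span f")
      case False
      then have "level f (translate (- s) a) - (f (0, 0) - t') \<in> tilde_span f"
        using that by (simp only: S_iff fwd2) simp
      with not_both[OF t'] have "level f (translate (- s) a) - t' \<notin> tilde_span f" by blast
      with False show ?thesis by (simp add: \<phi>_def \<psi>_def)
    qed (simp add: \<phi>_def \<psi>_def fwd1)
    show "\<phi> (\<psi> a) = a" if "a \<in> S'" for a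
    proof (cases "level f a - t' \<in> tilde_span f")
      case False
      then have "level f (translate s a) - (f (0, 0) - t) \<in> tilde_span f"
        using that by (simp only: S'_iff bwd2) simp
      with not_both[OF t] have "level f (translate s a) - t \<notin> tilde_span f" by blast
      with False show ?thesis by (simp add: \<phi>_def \<psi>_def)
    qed (simp add: \<phi>_def \<psi>_def bwd1)
  qed
  moreover have "(a, b) \<in> arcs (fdigraph f) \<longleftrightarrow> (\<phi> a, \<phi> b) \<in> arcs (fdigraph f)"
    if ab: "a \<in> S" "b \<in> S" for a b
  proof (cases "level f a - t \<in> tilde_span f"; cases "level f b - t \<in> tilde_span f")
    assume *: "level f a - t \<in> tilde_span f" "level f b - t \<in> tilde_span f"
    then have "(\<phi> a, \<phi> b) \<notin> arcs (fdigraph f)"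
      by (intro no_arc_within_half[OF t']) (simp_all add: \<phi>_def fwd1 del: translate_simps)
    with no_arc_within_half[OF t *] show ?thesis by simp
  next
    assume *: "level f a - t \<notin> tilde_span f" "level f b - t \<notin> tilde_span f"
    with ab have **: "level f a - (f (0, 0) - t) \<in> tilde_span f" "level f b - (f (0, 0) - t) \<in> tilde_span f"
      by (simp_all add: S_iff)
    with * have "(\<phi> a, \<phi> b) \<notin> arcs (fdigraph f)"
      by (intro no_arc_within_half[OF compl[OF t']]) (simp_all only: \<phi>_def if_False fwd2)
    with no_arc_within_half[OF compl[OF t] **] show ?thesis by simp
  qed (simp_all add: arcs_fdigraph_iff \<phi>_def)
  moreover from \<open>bij_betw \<phi> S S'\<close> have "\<phi> a \<in> S'" if "a \<in> S" for a
    using that by (auto simp: bij_betw_def)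
  ultimately have "digraph_iso (fdigraph f \<restriction> S) (fdigraph f \<restriction> S')"
    by (intro digraph_isoI_bij[where \<phi> = \<phi>] wf_digraph_induce_fdigraph)
      (simp_all add: arcs_induce_subgraph_iff del: induce_subgraph_arcs)
  then show ?thesis by (simp only: S_def S'_def)
qed

text \<open>
  In characteristic 2 the translation by \<open>s\<close> adds \<open>s + s = 0\<close> to the sum of the two ends of an arc,
  so it is an automorphism of the whole digraph; it moves the component of \<open>z\<close> onto that of \<open>z'\<close>.
\<close>

lemma digraph_iso_sccs_CHAR_2:
  fixes f :: "'a \<times> 'a \<Rightarrow> ('a :: finite_field) ^ 'l"
  assumes "CHAR('a) = 2"
  shows "digraph_iso (fdigraph f \<restriction> pre_digraph.scc_of (fdigraph f) z)
                     (fdigraph f \<restriction> pre_digraph.scc_of (fdigraph f) z')"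
proof -
  define s where "s = level f z' - level f z"
  define S S' where "S = pre_digraph.scc_of (fdigraph f) z" and "S' = pre_digraph.scc_of (fdigraph f) z'"
  have neg: "- v = v" for v :: "'a ^ 'l" by (rule CHAR_2_vec_double[OF assms])
  have double: "v + v = 0" for v :: "'a ^ 'l" by (rule CHAR_2_vec_double[OF assms])
  have invol: "translate s (translate s a) = a" for a :: "'a \<times> ('a ^ 'l)"
    using translate_simps(3)[of s a] by (simp only: neg)
  have eq1: "level f (translate s a) - level f z' = level f a - level f z" for a
    by (simp add: level_translate s_def)
  have eq2: "level f (translate s a) + level f z' - f (0, 0) = level f a + level f z - f (0, 0)" for a
  proof -
    have "level f (translate s a) + level f z' - f (0, 0)
        = level f a - level f z - f (0, 0) + (level f z' + level f z')"
      by (simp add: level_translate s_def algebra_simps)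
    also have "\<dots> = level f a + - level f z - f (0, 0)" by (simp add: double)
    finally show ?thesis by (simp only: neg)
  qed
  have mem: "translate s a \<in> S' \<longleftrightarrow> a \<in> S" for a
    by (simp only: S_def S'_def scc_of_fdigraph Un_iff mem_Collect_eq eq1 eq2)
  then have mem': "translate s a \<in> S \<longleftrightarrow> a \<in> S'" for a
    using invol by metis
  have bij: "bij_betw (translate s) S S'"
    by (rule bij_betwI[of _ _ _ "translate s"]) (simp_all add: mem mem' invol)
  have "snd a + s + (snd b + s) = snd a + snd b" for a b :: "'a \<times> ('a ^ 'l)"
    using double[of s] by (simp add: algebra_simps)
  then have "(a, b) \<in> arcs (fdigraph f) \<longleftrightarrow> (translate s a, translate s b) \<in> arcs (fdigraph f)" for a b
    by (simp add: arcs_fdigraph_iff)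
  with bij mem have "digraph_iso (fdigraph f \<restriction> S) (fdigraph f \<restriction> S')"
    by (intro digraph_isoI_bij[where \<phi> = "translate s"] wf_digraph_induce_fdigraph)
      (simp_all add: arcs_induce_subgraph_iff del: induce_subgraph_arcs)
  then show ?thesis by (simp only: S_def S'_def)
qed

text \<open>
  These identities turn every result on \<open>fdigraph f\<close> into one on \<open>fdigraph (f_zero f)\<close>, with the
  same span and with constant term 0.
\<close>

lemma f_zero_parts [simp]:
  "g_part (f_zero f) = g_part f" "h_part (f_zero f) = h_part f"
  "f_zero f (0, 0) = 0" "f_tilde_zero (f_zero f) = f_tilde_zero f"
  "tilde_span (f_zero f) = tilde_span f"
proof -
  show g: "g_part (f_zero f) = g_part f" and h: "h_part (f_zero f) = h_part f"
    by (simp_all add: g_part_def h_part_def f_zero_def fun_eq_iff)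
  show "f_zero f (0, 0) = 0" by (simp add: f_zero_def)
  show "f_tilde_zero (f_zero f) = f_tilde_zero f"
    by (simp add: f_tilde_zero_def g h) (simp add: f_zero_def)
  then show "tilde_span (f_zero f) = tilde_span f" by (simp add: tilde_span_def)
qed

lemma digraph_iso_f_zero:
  assumes r: "r + r = f (0, 0)"
  shows "digraph_iso (fdigraph f) (fdigraph (f_zero f))"
proof (rule digraph_isoI_bij[where \<phi> = "translate (- r)"])
  show "bij_betw (translate (- r)) (verts (fdigraph f)) (verts (fdigraph (f_zero f)))"
    by (rule bij_betwI[of _ _ _ "translate r"]) simp_all
  show "(u, v) \<in> arcs (fdigraph f) \<longleftrightarrow>
      (translate (- r) u, translate (- r) v) \<in> arcs (fdigraph (f_zero f))" for u v
    by (auto simp: arcs_fdigraph_iff f_zero_def algebra_simps simp flip: r)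
qed (simp_all add: wf_digraph_fdigraph)

text \<open>
  The vertex \<open>(0, r)\<close> lies in the self-opposite level class, so its component is this
  single class, which is everything only if \<open>tilde_span f\<close> is.
\<close>

lemma strongly_connected_fdigraph_iff:
  assumes r: "r + r = f (0, 0)"
  shows "strongly_connected (fdigraph f) \<longleftrightarrow> tilde_span f = UNIV"
proof
  assume sc: "strongly_connected (fdigraph f)"
  show "tilde_span f = UNIV"
  proof (intro equalityI subsetI)
    fix w :: "'a ^ 'b"
    have "(0, r) \<rightarrow>\<^sup>*\<^bsub>fdigraph f\<^esub> (0, w + r)"
      using sc by (auto simp: strongly_connected_def)
    then show "w \<in> tilde_span f"
      using r by (simp add: reachable_iff_level algebra_simps)
  qed simp
next
  assume "tilde_span f = UNIV"
  then show "strongly_connected (fdigraph f)"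
    by (auto simp: strongly_connected_def reachable_iff_level)
qed

section \<open>Counting the components\<close>

lemma card_vertices_eq:
  assumes "CARD('a :: finite_field) = p ^ e"
  shows "CARD('a \<times> ('a ^ 'l)) = p ^ (e + e * CARD('l))"
  using assms by (simp add: card_cartesian_product power_add power_mult flip: UNIV_Times_UNIV)

lemma card_tilde_span:
  fixes f :: "'a \<times> 'a \<Rightarrow> ('a :: finite_field) ^ 'l"
  assumes "prime p" "CARD('a) = p ^ e"
  shows "card (tilde_span f) = p ^ Fp.dim (tilde_span f)"
  using card_Fp_subspace[OF subspace_tilde_span[of f]] CARD_prime_field[OF assms] by simp

lemma tilde_span_UNIV_iff:
  fixes f :: "'a \<times> 'a \<Rightarrow> ('a :: finite_field) ^ 'l"
  assumes "prime p" "CARD('a) = p ^ e"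
  shows "tilde_span f = UNIV \<longleftrightarrow> Fp.dim (tilde_span f) = e * CARD('l)"
proof -
  have "tilde_span f = UNIV \<longleftrightarrow> card (tilde_span f) = CARD('a ^ 'l)"
    using card_subset_eq[of UNIV "tilde_span f"] by auto
  also have "\<dots> \<longleftrightarrow> p ^ Fp.dim (tilde_span f) = p ^ (e * CARD('l))"
    using card_tilde_span[OF assms, of f] assms(2) by (simp add: power_mult)
  also have "\<dots> \<longleftrightarrow> Fp.dim (tilde_span f) = e * CARD('l)"
    using prime_gt_1_nat[OF assms(1)] by simp
  finally show ?thesis .
qed

lemma sccs_fdigraph:
  "pre_digraph.sccs (fdigraph f) = range (\<lambda>z. fdigraph f \<restriction> pre_digraph.scc_of (fdigraph f) z)"
  using sccs_conv_scc_of[OF wf_digraph_fdigraph] by simp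

lemma sum_card_sccs_fdigraph:
  fixes f :: "'a \<times> 'a \<Rightarrow> ('a :: finite_field) ^ 'l"
  shows "(\<Sum>C\<in>pre_digraph.sccs (fdigraph f). card (verts C)) = CARD('a \<times> ('a ^ 'l))"
  using fin_digraph.sum_card_sccs[OF fin_digraph_fdigraph[of f]] by (simp only: fdigraph_simps)

lemma power_int_nat_diff:
  "x \<noteq> 0 \<Longrightarrow> x powi (int m - int n) = x ^ m / x ^ n" for x :: "'a :: field"
  by (simp add: power_int_diff)

text \<open>
  The component \<open>C\<close> of \<open>(0, r)\<close>, where \<open>r\<close> is half of \<open>f (0, 0)\<close>, is the only one with a single level
  class: if twice a level is \<open>f (0, 0)\<close> modulo the span, halving puts that level in the class of \<open>r\<close>.  The
  number \<open>n\<close> of other components then comes from adding up sizes,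
  \<open>q * q ^ l = p ^ (e + d) + n * 2 * p ^ (e + d)\<close>.
\<close>

lemma components_odd:
  fixes f :: "'a \<times> 'a \<Rightarrow> ('a :: finite_field) ^ 'l"
  assumes p: "prime p" and q: "CARD('a) = p ^ e" and "odd p"
    and G: "G = fdigraph f" and d: "d = Fp.dim (tilde_span f)"
  shows "real (card (pre_digraph.sccs G)) = (real p powi (int (e * CARD('l)) - int d) + 1) / 2"
    and "\<exists>C \<in> pre_digraph.sccs G.
          card (verts C) = p ^ (e + d) \<and>
          real (card (pre_digraph.sccs G - {C})) = (real p powi (int (e * CARD('l)) - int d) - 1) / 2 \<and>
          (\<forall>C\<^sub>1 \<in> pre_digraph.sccs G - {C}. \<forall>C\<^sub>2 \<in> pre_digraph.sccs G - {C}. digraph_iso C\<^sub>1 C\<^sub>2) \<and>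
          (\<forall>C' \<in> pre_digraph.sccs G - {C}. card (verts C') = 2 * p ^ (e + d))"
proof -
  have char: "odd CHAR('a)" using CHAR_eq_of_CARD[OF p q] \<open>odd p\<close> by simp
  obtain r where r: "r + r = f (0, 0)" using exists_half[OF char] .
  have size: "CARD('a) * card (tilde_span f) = p ^ (e + d)"
    using card_tilde_span[OF p q, of f] q d by (simp add: power_add)
  define C where "C = G \<restriction> pre_digraph.scc_of G (0, r)"
  have C_in: "C \<in> pre_digraph.sccs G" by (simp add: C_def G sccs_fdigraph)
  have card_C: "card (verts C) = p ^ (e + d)"
    by (simp add: C_def G card_scc_of_fdigraph r size)
  have selfdual: "G \<restriction> pre_digraph.scc_of G z = C"
    if "level f z + level f z - f (0, 0) \<in> tilde_span f" for z
  proof -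
    have "level f z + level f z - f (0, 0) = (level f z - r) + (level f z - r)"
      using r by (simp add: algebra_simps)
    with that have "level f z - r \<in> tilde_span f"
      using Fp_subspace_half[OF subspace_tilde_span char] by metis
    then have "z \<in> pre_digraph.scc_of G (0, r)" by (simp add: G scc_of_fdigraph)
    then have "pre_digraph.scc_of G z = pre_digraph.scc_of G (0, r)"
      unfolding G by (rule wf_digraph.scc_of_eq[OF wf_digraph_fdigraph])
    then show ?thesis by (simp add: C_def)
  qed
  have others: "\<exists>z. C' = G \<restriction> pre_digraph.scc_of G z \<and> level f z + level f z - f (0, 0) \<notin> tilde_span f"
    if C': "C' \<in> pre_digraph.sccs G - {C}" for C'
  proof -
    from C' obtain z where z: "C' = G \<restriction> pre_digraph.scc_of G z" by (auto simp: G sccs_fdigraph)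
    with C' selfdual[of z] show ?thesis by blast
  qed
  have card_others: "card (verts C') = 2 * p ^ (e + d)" if "C' \<in> pre_digraph.sccs G - {C}" for C'
    using others[OF that] by (auto simp: G card_scc_of_fdigraph size)
  have iso: "digraph_iso C\<^sub>1 C\<^sub>2"
    if "C\<^sub>1 \<in> pre_digraph.sccs G - {C}" "C\<^sub>2 \<in> pre_digraph.sccs G - {C}" for C\<^sub>1 C\<^sub>2
    using others[OF that(1)] others[OF that(2)] digraph_iso_sccs_two_halves by (metis G)
  define n where "n = card (pre_digraph.sccs G - {C})"
  have fin: "finite (pre_digraph.sccs G)" by (simp add: G)
  have "p ^ (e + e * CARD('l)) = (\<Sum>C\<in>pre_digraph.sccs G. card (verts C))"
    using sum_card_sccs_fdigraph[of f] card_vertices_eq[OF q, where 'l = 'l] by (simp add: G)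
  also have "\<dots> = card (verts C) + (\<Sum>C'\<in>pre_digraph.sccs G - {C}. card (verts C'))"
    by (rule sum.remove[OF fin C_in])
  also have "\<dots> = p ^ (e + d) + n * (2 * p ^ (e + d))"
    using card_others by (simp add: card_C n_def)
  finally have "p ^ e * p ^ (e * CARD('l)) = p ^ e * (p ^ d * (1 + 2 * n))"
    by (simp add: power_add algebra_simps)
  then have "p ^ (e * CARD('l)) = p ^ d * (1 + 2 * n)"
    using prime_gt_0_nat[OF p] by simp
  then have "real p ^ (e * CARD('l)) = real p ^ d * (1 + 2 * real n)"
    by (simp only: of_nat_mult of_nat_power of_nat_add of_nat_1 of_nat_numeral flip: of_nat_eq_iff[where 'a = real])
  then have pow: "real p powi (int (e * CARD('l)) - int d) = 1 + 2 * real n"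
    using prime_gt_0_nat[OF p] by (subst power_int_nat_diff) simp_all
  have "card (pre_digraph.sccs G) = Suc n"
    using card.remove[OF fin C_in] by (simp add: n_def)
  with pow show "real (card (pre_digraph.sccs G)) = (real p powi (int (e * CARD('l)) - int d) + 1) / 2"
    by simp
  show "\<exists>C \<in> pre_digraph.sccs G.
          card (verts C) = p ^ (e + d) \<and>
          real (card (pre_digraph.sccs G - {C})) = (real p powi (int (e * CARD('l)) - int d) - 1) / 2 \<and>
          (\<forall>C\<^sub>1 \<in> pre_digraph.sccs G - {C}. \<forall>C\<^sub>2 \<in> pre_digraph.sccs G - {C}. digraph_iso C\<^sub>1 C\<^sub>2) \<and>
          (\<forall>C' \<in> pre_digraph.sccs G - {C}. card (verts C') = 2 * p ^ (e + d))"
    using C_in card_C card_others iso pow by (intro bexI[of _ C]) (auto simp flip: n_def)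
qed

text \<open>
  Twice a level is 0, so whether the two level classes of a component coincide depends only
  on \<open>f (0, 0)\<close>; all components have the same size, and the size determines their number.
\<close>

lemma components_even:
  fixes f :: "'a \<times> 'a \<Rightarrow> ('a :: finite_field) ^ 'l"
  assumes q: "CARD('a) = 2 ^ e"
    and D: "D = fdigraph f" and d: "d = Fp.dim (tilde_span f)"
  shows "f (0, 0) \<in> tilde_span f \<Longrightarrow>
          real (card (pre_digraph.sccs D)) = 2 powi (int (e * CARD('l)) - int d) \<and>
          (\<forall>C \<in> pre_digraph.sccs D. card (verts C) = 2 ^ (e + d))"
    and "f (0, 0) \<notin> tilde_span f \<Longrightarrow>
          real (card (pre_digraph.sccs D)) = 2 powi (int (e * CARD('l)) - int d - 1) \<and>
          (\<forall>C \<in> pre_digraph.sccs D. card (verts C) = 2 ^ (e + d + 1))"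
proof -
  have two: "prime (2 :: nat)" by simp
  have size: "CARD('a) * card (tilde_span f) = 2 ^ (e + d)"
    using card_tilde_span[OF two q, of f] q d by (simp add: power_add)
  have double: "v + v = 0" for v :: "'a ^ 'l"
    by (rule CHAR_2_vec_double[OF CHAR_eq_of_CARD[OF two q]])
  have in_iff: "- f (0, 0) \<in> tilde_span f \<longleftrightarrow> f (0, 0) \<in> tilde_span f"
    using CHAR_2_vec_double(2)[OF CHAR_eq_of_CARD[OF two q]] by metis
  have sizes: "card (verts C) = (if f (0, 0) \<in> tilde_span f then 1 else 2) * 2 ^ (e + d)"
    if "C \<in> pre_digraph.sccs D" for C
    using that by (auto simp: D sccs_fdigraph card_scc_of_fdigraph size double in_iff)
  define n where "n = card (pre_digraph.sccs D)"
  have "2 ^ (e + e * CARD('l)) = (\<Sum>C\<in>pre_digraph.sccs D. card (verts C))"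
    using sum_card_sccs_fdigraph[of f] card_vertices_eq[OF q, where 'l = 'l] by (simp add: D)
  also have "\<dots> = n * ((if f (0, 0) \<in> tilde_span f then 1 else 2) * 2 ^ (e + d))"
    by (simp add: sizes n_def)
  finally have "2 ^ e * 2 ^ (e * CARD('l)) = 2 ^ e * (n * ((if f (0, 0) \<in> tilde_span f then 1 else 2) * 2 ^ d))"
    by (simp add: power_add algebra_simps)
  then have "2 ^ (e * CARD('l)) = n * ((if f (0, 0) \<in> tilde_span f then 1 else 2) * 2 ^ d)"
    by simp
  then have real_n: "(2 :: real) ^ (e * CARD('l)) = real n * ((if f (0, 0) \<in> tilde_span f then 1 else 2) * 2 ^ d)"
    by (simp only: of_nat_mult of_nat_power of_nat_1 of_nat_numeral if_distrib[of real] flip: of_nat_eq_iff[where 'a = real])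
  have pow: "(2 :: real) powi (int (e * CARD('l)) - int d) = 2 ^ (e * CARD('l)) / 2 ^ d"
    by (rule power_int_nat_diff) simp
  have pow': "(2 :: real) powi (int (e * CARD('l)) - int d - 1) = 2 ^ (e * CARD('l)) / 2 ^ d / 2"
    using power_int_diff[of "2 :: real" "int (e * CARD('l)) - int d" 1] by (simp only: pow) simp
  show "real (card (pre_digraph.sccs D)) = 2 powi (int (e * CARD('l)) - int d) \<and>
          (\<forall>C \<in> pre_digraph.sccs D. card (verts C) = 2 ^ (e + d))"
    if "f (0, 0) \<in> tilde_span f"
    unfolding pow using real_n that by (simp add: sizes flip: n_def)
  show "real (card (pre_digraph.sccs D)) = 2 powi (int (e * CARD('l)) - int d - 1) \<and>
          (\<forall>C \<in> pre_digraph.sccs D. card (verts C) = 2 ^ (e + d + 1))"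
    if "f (0, 0) \<notin> tilde_span f"
    unfolding pow' using real_n that by (simp add: sizes flip: n_def)
qed

text \<open>
  \<open>f_tilde f\<close> and \<open>f_tilde_zero f\<close> differ by the constant \<open>f (0, 0)\<close>, which is the value of
  \<open>f_tilde f\<close> at \<open>(0, 0)\<close>.
\<close>

lemma sum_span_eq_span_f_tilde:
  "{w + z | w z. w \<in> tilde_span f \<and> z \<in> Fp.span {f (0, 0)}} = Fp.span (range (f_tilde f))"
proof -
  have tilde: "f_tilde f z = f_tilde_zero f z + f (0, 0)" for z
    by (cases z) (simp add: f_tilde_def f_tilde_zero_def f_zero_def)
  have "f_tilde f (0, 0) = f (0, 0)" by (simp add: f_tilde_def)
  then have const: "f (0, 0) \<in> Fp.span (range (f_tilde f))"
    by (metis Fp.span_base rangeI)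
  have "Fp.span (range (f_tilde_zero f) \<union> {f (0, 0)}) = Fp.span (range (f_tilde f))"
  proof (rule Fp.span_eq[THEN iffD2, OF conjI])
    have "f_tilde_zero f z \<in> Fp.span (range (f_tilde f))" for z
    proof -
      have "f_tilde_zero f z = f_tilde f z - f (0, 0)" by (simp add: tilde)
      then show ?thesis using const by (simp add: Fp.span_diff Fp.span_base)
    qed
    with const show "range (f_tilde_zero f) \<union> {f (0, 0)} \<subseteq> Fp.span (range (f_tilde f))" by auto
    show "range (f_tilde f) \<subseteq> Fp.span (range (f_tilde_zero f) \<union> {f (0, 0)})"
      by (auto simp: tilde intro!: Fp.span_add intro: Fp.span_base)
  qed
  then show ?thesis by (simp only: Fp.span_Un tilde_span_def)
qed

text \<open>
  In characteristic 2 the span of one vector consists of that vector and 0.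
\<close>

lemma sum_span_CHAR_2_iff:
  fixes f :: "'a \<times> 'a \<Rightarrow> ('a :: finite_field) ^ 'l"
  assumes "CHAR('a) = 2"
  shows "v \<in> {w + z | w z. w \<in> tilde_span f \<and> z \<in> Fp.span {f (0, 0)}} \<longleftrightarrow>
           v \<in> tilde_span f \<or> v - f (0, 0) \<in> tilde_span f" (is "?L \<longleftrightarrow> ?R")
proof
  have "Fp.span {f (0, 0)} \<subseteq> {0, f (0, 0)}"
    by (intro Fp.span_minimal Fp_subspaceI_additive) (auto simp: CHAR_2_vec_double[OF assms])
  moreover assume ?L
  ultimately obtain w z where "v = w + z" "w \<in> tilde_span f" "z = 0 \<or> z = f (0, 0)" by blast
  then show ?R by auto
next
  assume ?R
  then obtain z where "v - z \<in> tilde_span f" "z \<in> Fp.span {f (0, 0)}"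
    using Fp.span_zero[of "{f (0, 0)}"] Fp.span_base[of "f (0, 0)" "{f (0, 0)}"]
    by (metis diff_zero insertI1)
  moreover have "v = (v - z) + z" by simp
  ultimately show ?L by blast
qed

section \<open>Strong components of the digraph of a function\<close>

theorem theorem1:
  fixes f :: "'a \<times> 'a \<Rightarrow> ('a :: finite_field) ^ 'l"
    and p e l q d :: nat
  defines "g \<equiv> g_part f" and "h \<equiv> h_part f"
    and "D \<equiv> fdigraph f" and "D\<^sub>0 \<equiv> fdigraph (f_zero f)"
    and "W\<^sub>0 \<equiv> Fp.span (range (f_tilde_zero f))"
    and "W \<equiv> {w + z | w z. w \<in> Fp.span (range (f_tilde_zero f)) \<and> z \<in> Fp.span {f (0, 0)}}"
  assumes p: "prime p" and e: "e > 0" and l: "CARD('l) = l"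
    and q: "q = p ^ e" "CARD('a) = q"
    and d: "d = Fp.dim W\<^sub>0"
  shows
    "(odd q \<longrightarrow>
       digraph_iso D D\<^sub>0 \<and>
       (\<forall>u v. \<exists>C. strong_component_at D\<^sub>0 (u, v) C \<and>
          verts C = {(a, v + h a - g u + w) | a w. w \<in> W\<^sub>0}
                  \<union> {(b, - v + h b + g u + w) | b w. w \<in> W\<^sub>0}) \<and>
       (\<forall>u v. \<exists>C. strong_component_at D (u, v) C \<and>
          verts C = {(a, v + h a - g u + w) | a w. w \<in> W\<^sub>0}
                  \<union> {(b, - v + h b + g u + f (0, 0) + w) | b w. w \<in> W\<^sub>0}) \<and>
       (strongly_connected D \<longleftrightarrow> W\<^sub>0 = UNIV) \<and>
       (strongly_connected D\<^sub>0 \<longleftrightarrow> W\<^sub>0 = UNIV) \<and>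
       (W\<^sub>0 = UNIV \<longleftrightarrow> d = e * l))
     \<and>
     (even q \<longrightarrow>
       (\<forall>u v. \<exists>C. strong_component_at D (u, v) C \<and>
          verts C = {(a, v + h a + g u + w) | a w. w \<in> W\<^sub>0}
                  \<union> {(a, v + h a + g u + f (0, 0) + w) | a w. w \<in> W\<^sub>0} \<and>
          verts C = {(a, v + h a + g u + w) | a w. w \<in> W}) \<and>
       W = Fp.span (range (f_tilde f)))
     \<and>
     (odd q \<longrightarrow> (\<forall>G \<in> {D, D\<^sub>0}.
       real (card (pre_digraph.sccs G)) = (real p powi (int (e * l) - int d) + 1) / 2 \<and>
       (\<exists>C \<in> pre_digraph.sccs G.
          card (verts C) = p ^ (e + d) \<and>
          real (card (pre_digraph.sccs G - {C})) = (real p powi (int (e * l) - int d) - 1) / 2 \<and>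
          (\<forall>C\<^sub>1 \<in> pre_digraph.sccs G - {C}. \<forall>C\<^sub>2 \<in> pre_digraph.sccs G - {C}. digraph_iso C\<^sub>1 C\<^sub>2) \<and>
          (\<forall>C' \<in> pre_digraph.sccs G - {C}. card (verts C') = 2 * p ^ (e + d)))))
     \<and>
     (even q \<longrightarrow>
       (f (0, 0) \<in> W\<^sub>0 \<longrightarrow>
          real (card (pre_digraph.sccs D)) = 2 powi (int (e * l) - int d) \<and>
          (\<forall>C \<in> pre_digraph.sccs D. card (verts C) = 2 ^ (e + d))) \<and>
       (f (0, 0) \<notin> W\<^sub>0 \<longrightarrow>
          real (card (pre_digraph.sccs D)) = 2 powi (int (e * l) - int d - 1) \<and>
          (\<forall>C \<in> pre_digraph.sccs D. card (verts C) = 2 ^ (e + d + 1))) \<and>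
       (\<forall>C\<^sub>1 \<in> pre_digraph.sccs D. \<forall>C\<^sub>2 \<in> pre_digraph.sccs D. digraph_iso C\<^sub>1 C\<^sub>2))"
proof -
  have W0: "W\<^sub>0 = tilde_span f" by (simp add: W\<^sub>0_def tilde_span_def)
  have W: "W = {w + z | w z. w \<in> tilde_span f \<and> z \<in> Fp.span {f (0, 0)}}"
    by (simp only: W_def tilde_span_def)
  have card_a: "CARD('a) = p ^ e" using q by simp
  have odd_char: "odd CHAR('a)" if "odd q"
    using that CHAR_eq_of_CARD[OF p card_a] q e by simp
  have p_2: "p = 2" if "even q"
    using that q p by (metis dvd_refl even_power primes_dvd_imp_eq two_is_prime_nat)
  have component: "strong_component_at (fdigraph f') z (fdigraph f' \<restriction> pre_digraph.scc_of (fdigraph f') z)"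
    for f' :: "'a \<times> 'a \<Rightarrow> 'a ^ 'l" and z
    by (rule strong_component_at_scc_of) (simp_all add: wf_digraph_fdigraph)
  have component_sets: "\<exists>C. strong_component_at (fdigraph f') (u, v) C \<and>
          verts C = {(a, v + h_part f' a - g_part f' u + w) | a w. w \<in> tilde_span f'}
                  \<union> {(b, - v + h_part f' b + g_part f' u + f' (0, 0) + w) | b w. w \<in> tilde_span f'}"
    for f' :: "'a \<times> 'a \<Rightarrow> 'a ^ 'l" and u v
    unfolding level_vertex_sets
    using component[of f' "(u, v)"] scc_of_fdigraph[of f' "(u, v)"] by (metis induce_subgraph_verts)
  have part_i_odd: "digraph_iso D D\<^sub>0 \<and>
       (\<forall>u v. \<exists>C. strong_component_at D\<^sub>0 (u, v) C \<and>
          verts C = {(a, v + h a - g u + w) | a w. w \<in> W\<^sub>0}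
                  \<union> {(b, - v + h b + g u + w) | b w. w \<in> W\<^sub>0}) \<and>
       (\<forall>u v. \<exists>C. strong_component_at D (u, v) C \<and>
          verts C = {(a, v + h a - g u + w) | a w. w \<in> W\<^sub>0}
                  \<union> {(b, - v + h b + g u + f (0, 0) + w) | b w. w \<in> W\<^sub>0}) \<and>
       (strongly_connected D \<longleftrightarrow> W\<^sub>0 = UNIV) \<and>
       (strongly_connected D\<^sub>0 \<longleftrightarrow> W\<^sub>0 = UNIV) \<and>
       (W\<^sub>0 = UNIV \<longleftrightarrow> d = e * l)" if odd: "odd q"
  proof (intro conjI allI)
    obtain r where r: "r + r = f (0, 0)" using exists_half[OF odd_char[OF odd]] .
    show "digraph_iso D D\<^sub>0"
      unfolding D_def D\<^sub>0_def using r by (rule digraph_iso_f_zero)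
    show "\<exists>C. strong_component_at D\<^sub>0 (u, v) C \<and>
          verts C = {(a, v + h a - g u + w) | a w. w \<in> W\<^sub>0}
                  \<union> {(b, - v + h b + g u + w) | b w. w \<in> W\<^sub>0}" for u v
      using component_sets[of "f_zero f" u v]
      by (simp only: D\<^sub>0_def g_def h_def W0 f_zero_parts add_0_right)
    show "\<exists>C. strong_component_at D (u, v) C \<and>
          verts C = {(a, v + h a - g u + w) | a w. w \<in> W\<^sub>0}
                  \<union> {(b, - v + h b + g u + f (0, 0) + w) | b w. w \<in> W\<^sub>0}" for u v
      unfolding D_def g_def h_def W0 by (rule component_sets)
    show "strongly_connected D \<longleftrightarrow> W\<^sub>0 = UNIV"
      unfolding D_def W0 using r by (rule strongly_connected_fdigraph_iff)
    show "strongly_connected D\<^sub>0 \<longleftrightarrow> W\<^sub>0 = UNIV"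
      using strongly_connected_fdigraph_iff[of 0 "f_zero f"] by (simp add: D\<^sub>0_def W0)
    show "W\<^sub>0 = UNIV \<longleftrightarrow> d = e * l"
      using tilde_span_UNIV_iff[OF p card_a, of f] by (simp only: d W0 l)
  qed
  have part_i_even: "(\<forall>u v. \<exists>C. strong_component_at D (u, v) C \<and>
          verts C = {(a, v + h a + g u + w) | a w. w \<in> W\<^sub>0}
                  \<union> {(a, v + h a + g u + f (0, 0) + w) | a w. w \<in> W\<^sub>0} \<and>
          verts C = {(a, v + h a + g u + w) | a w. w \<in> W}) \<and>
       W = Fp.span (range (f_tilde f))" if "even q"
  proof (intro conjI allI)
    have char: "CHAR('a) = 2" using CHAR_eq_of_CARD[OF p card_a] p_2[OF that] by simp
    have neg: "- v = v" for v :: "'a ^ 'l" by (rule CHAR_2_vec_double[OF char])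
    have minus: "w - v = w + v" for v w :: "'a ^ 'l"
      using neg[of v] by (metis diff_conv_add_uminus)
    fix u v
    obtain C where C: "strong_component_at D (u, v) C"
      "verts C = {(a, v + h a + g u + w) | a w. w \<in> W\<^sub>0}
                  \<union> {(a, v + h a + g u + f (0, 0) + w) | a w. w \<in> W\<^sub>0}"
      using component_sets[of f u v] unfolding minus neg D_def g_def h_def W0 by blast
    have "{(a, k a + w) | a w. w \<in> W} =
        {(a, k a + w) | a w. w \<in> W\<^sub>0} \<union> {(a, k a + f (0, 0) + w) | a w. w \<in> W\<^sub>0}" for k :: "'a \<Rightarrow> 'a ^ 'l"
    proof -
      have "w \<in> W \<longleftrightarrow> w \<in> W\<^sub>0 \<or> w - f (0, 0) \<in> W\<^sub>0" for w
        unfolding W W0 by (rule sum_span_CHAR_2_iff[OF char])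
      moreover have "w - f (0, 0) \<in> W\<^sub>0 \<longleftrightarrow> w \<in> (+) (f (0, 0)) ` W\<^sub>0" for w
        by (auto intro: rev_image_eqI[of "w - f (0, 0)"])
      ultimately have W_eq: "W = W\<^sub>0 \<union> (+) (f (0, 0)) ` W\<^sub>0" by blast
      show ?thesis unfolding W_eq add.assoc by blast
    qed
    with C show "\<exists>C. strong_component_at D (u, v) C \<and>
          verts C = {(a, v + h a + g u + w) | a w. w \<in> W\<^sub>0}
                  \<union> {(a, v + h a + g u + f (0, 0) + w) | a w. w \<in> W\<^sub>0} \<and>
          verts C = {(a, v + h a + g u + w) | a w. w \<in> W}"
      by (intro exI[of _ C]) simp
  next
    show "W = Fp.span (range (f_tilde f))" unfolding W by (rule sum_span_eq_span_f_tilde)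
  qed
  have part_ii_odd: "\<forall>G \<in> {D, D\<^sub>0}.
       real (card (pre_digraph.sccs G)) = (real p powi (int (e * l) - int d) + 1) / 2 \<and>
       (\<exists>C \<in> pre_digraph.sccs G.
          card (verts C) = p ^ (e + d) \<and>
          real (card (pre_digraph.sccs G - {C})) = (real p powi (int (e * l) - int d) - 1) / 2 \<and>
          (\<forall>C\<^sub>1 \<in> pre_digraph.sccs G - {C}. \<forall>C\<^sub>2 \<in> pre_digraph.sccs G - {C}. digraph_iso C\<^sub>1 C\<^sub>2) \<and>
          (\<forall>C' \<in> pre_digraph.sccs G - {C}. card (verts C') = 2 * p ^ (e + d)))" if "odd q"
  proof -
    have "odd p" using that q e by simp
    show ?thesis
    proof
      fix G assume "G \<in> {D, D\<^sub>0}"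
      then obtain f' :: "'a \<times> 'a \<Rightarrow> 'a ^ 'l"
        where G: "G = fdigraph f'" and "tilde_span f' = tilde_span f"
        unfolding D_def D\<^sub>0_def using f_zero_parts(5) by blast
      then have "d = Fp.dim (tilde_span f')" by (simp only: d W0)
      from components_odd[OF p card_a \<open>odd p\<close> G this, unfolded l]
      show "real (card (pre_digraph.sccs G)) = (real p powi (int (e * l) - int d) + 1) / 2 \<and>
       (\<exists>C \<in> pre_digraph.sccs G.
          card (verts C) = p ^ (e + d) \<and>
          real (card (pre_digraph.sccs G - {C})) = (real p powi (int (e * l) - int d) - 1) / 2 \<and>
          (\<forall>C\<^sub>1 \<in> pre_digraph.sccs G - {C}. \<forall>C\<^sub>2 \<in> pre_digraph.sccs G - {C}. digraph_iso C\<^sub>1 C\<^sub>2) \<and>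
          (\<forall>C' \<in> pre_digraph.sccs G - {C}. card (verts C') = 2 * p ^ (e + d)))"
        by (rule conjI)
    qed
  qed
  have part_ii_even: "(f (0, 0) \<in> W\<^sub>0 \<longrightarrow>
          real (card (pre_digraph.sccs D)) = 2 powi (int (e * l) - int d) \<and>
          (\<forall>C \<in> pre_digraph.sccs D. card (verts C) = 2 ^ (e + d))) \<and>
       (f (0, 0) \<notin> W\<^sub>0 \<longrightarrow>
          real (card (pre_digraph.sccs D)) = 2 powi (int (e * l) - int d - 1) \<and>
          (\<forall>C \<in> pre_digraph.sccs D. card (verts C) = 2 ^ (e + d + 1))) \<and>
       (\<forall>C\<^sub>1 \<in> pre_digraph.sccs D. \<forall>C\<^sub>2 \<in> pre_digraph.sccs D. digraph_iso C\<^sub>1 C\<^sub>2)" if "even q"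
  proof -
    have card_2: "CARD('a) = 2 ^ e" using card_a p_2[OF that] by simp
    have char: "CHAR('a) = 2" using CHAR_eq_of_CARD[OF p card_a] p_2[OF that] by simp
    have "d = Fp.dim (tilde_span f)" by (simp add: d W0)
    note even = components_even[OF card_2 D_def[THEN meta_eq_to_obj_eq] this, unfolded l]
    have "digraph_iso C\<^sub>1 C\<^sub>2" if "C\<^sub>1 \<in> pre_digraph.sccs D" "C\<^sub>2 \<in> pre_digraph.sccs D" for C\<^sub>1 C\<^sub>2
      using that digraph_iso_sccs_CHAR_2[OF char] by (auto simp: D_def sccs_fdigraph)
    with even show ?thesis unfolding W0 by blast
  qed
  from part_i_odd part_i_even part_ii_odd part_ii_even show ?thesis by blast
qed

end
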